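(* Let $V\in\mathbb{C}\langle x\rangle$ be a polynomial in one variable $x$, and expand its derivative $\xi:=DV(x)$ in the Chebyshev polynomials of the first kind, $$\xi=DV(x)=\sum_{n\ge 0}\alpha_n C_n(x),$$ where $\alpha_n\in\mathbb{C}$ and only finitely many $\alpha_n$ are nonzero. Assume that $V$ is normalized so that $\alpha_0=0$ and $\alpha_1=1$. Define a linear functional $\varphi_1:\mathbb{C}\langle x\rangle\to\mathbb{C}$ by $$\varphi_1(S_n(x)):=\alpha_{n+1}\qquad(n\ge 0),$$ and a bilinear functional $\varphi_2:\mathbb{C}\langle x\rangle\times\mathbb{C}\langle x\rangle\to\mathbb{C}$ by $$\varphi_2(C_n(x),C_m(x)):=n\,\delta_{nm}\qquad(n,m\ge 0).$$ Then $\varphi_1$ and $\varphi_2$ satisfy the first and second order Schwinger-Dyson equations for the potential $V$; that is, for all $p,q\in\mathbb{C}\langle x\rangle$, $$\varphi_1\bigl(\xi\, p(x)\bigr)=(\varphi_1\otimes\varphi_1)\bigl(\partial p(x)\bigr)$$ and $$\varphi_2\bigl(\xi\, p(x),q(x)\bigr)=\varphi_2\bigl([\varphi_1\otimes\mathrm{id}+\mathrm{id}\otimes\varphi_1](\partial p(x)),\,q(x)\bigr)+\varphi_1\bigl(p(x)\,Dq(x)\bigr).$$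
   Context: $\mathbb{C}\langle x\rangle$ denotes the algebra of complex polynomials in one variable $x$. Derivatives: $D:\mathbb{C}\langle x\rangle\to\mathbb{C}\langle x\rangle$ is the usual derivative, $Dx^n=nx^{n-1}$. $\partial:\mathbb{C}\langle x\rangle\to\mathbb{C}\langle x\rangle\otimes\mathbb{C}\langle x\rangle$ is the linear map (non-commutative derivative) given by $\partial x^n=\sum_{k=0}^{n-1}x^k\otimes x^{n-k-1}$ (so $\partial 1=0$). For a linear functional $\varphi_1$ on $\mathbb{C}\langle x\rangle$, the maps $\varphi_1\otimes\varphi_1$, $\varphi_1\otimes\mathrm{id}$, $\mathrm{id}\otimes\varphi_1$ on $\mathbb{C}\langle x\rangle\otimes\mathbb{C}\langle x\rangle$ are the linear maps with $(\varphi_1\otimes\varphi_1)(f\otimes g)=\varphi_1(f)\varphi_1(g)$, $(\varphi_1\otimes\mathrm{id})(f\otimes g)=\varphi_1(f)\,g$, $(\mathrm{id}\otimes\varphi_1)(f\otimes g)=\varphi_1(g)\,f$. Chebyshev polynomials (rescaled to the interval $[-2,2]$): the first kind $C_n$ are defined by $C_0(x)=2$, $C_1(x)=x$, and $xC_n(x)=C_{n+1}(x)+C_{n-1}(x)$ for $n\ge1$ (so $C_2=x^2-2$, $C_3=x^3-3x$); the second kind $S_n$ are defined by $S_0(x)=1$, $S_1(x)=x$, and $xS_n(x)=S_{n+1}(x)+S_{n-1}(x)$ for $n\ge1$ (so $S_2=x^2-1$, $S_3=x^3-2x$). Both $\{S_n\mid n\ge 0\}$ and $\{C_n\mid n\ge0\}$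 are linear bases of $\mathbb{C}\langle x\rangle$, so $\varphi_1$ and $\varphi_2$ are well defined by the prescriptions in the claim; note $\varphi_1(1)=\alpha_1=1$. *)

theory Defs
  imports Complex_Main "HOL-Computational_Algebra.Polynomial"
begin

section \<open>Complex-linear and bilinear maps on polynomials\<close>

text \<open>
  The constant \<open>linear\<close> of the library means real-linear; complex linearity has to be spelled out
  with the relocatable locale. The target is a complex vector space with scalar multiplication \<open>s\<close>.
\<close>

abbreviation poly_linear :: "(complex \<Rightarrow> 'v::ab_group_add \<Rightarrow> 'v) \<Rightarrow> (complex poly \<Rightarrow> 'v) \<Rightarrow> bool"
  where "poly_linear s f \<equiv> Vector_Spaces.linear smult s f"

definition poly_bilinear ::
    "(complex \<Rightarrow> 'v::ab_group_add \<Rightarrow> 'v) \<Rightarrow> (complex poly \<Rightarrow> complex poly \<Rightarrow> 'v) \<Rightarrow> bool"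
  where "poly_bilinear s B \<longleftrightarrow>
    (\<forall>q. poly_linear s (\<lambda>p. B p q)) \<and> (\<forall>p. poly_linear s (\<lambda>q. B p q))"

lemma vector_space_smult: "vector_space (smult :: complex \<Rightarrow> complex poly \<Rightarrow> complex poly)"
  by unfold_locales (simp_all add: smult_add_left smult_add_right)

lemma vector_space_times: "vector_space ((*) :: complex \<Rightarrow> complex \<Rightarrow> complex)"
  by unfold_locales (simp_all add: algebra_simps)


section \<open>The tensor square of the polynomial algebra\<close>

text \<open>
  The tensor square is modelled by polynomials in \<open>x\<close> whose coefficients are polynomials (the second
  tensor factor): \<open>f \<otimes> g\<close> has the \<open>i\<close>-th coefficient \<open>coeff f i \<cdot> g\<close>. The lemmas
  \<open>tensor_bilinear\<close>, \<open>tensor_lift_linear\<close>, \<open>tensor_lift_tensor\<close> and \<open>tensor_lift_unique\<close> are the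
  universal property of the tensor product.
\<close>

type_synonym poly_tensor = "complex poly poly"

definition tensor :: "complex poly \<Rightarrow> complex poly \<Rightarrow> poly_tensor"
  where "tensor f g = map_poly (\<lambda>c. smult c g) f"

definition tensor_scale :: "complex \<Rightarrow> poly_tensor \<Rightarrow> poly_tensor"
  where "tensor_scale c = smult [:c:]"

text \<open>The linear map on the tensor square induced by a bilinear map:\<close>

definition tensor_lift :: "(complex poly \<Rightarrow> complex poly \<Rightarrow> 'v::ab_group_add) \<Rightarrow> poly_tensor \<Rightarrow> 'v"
  where "tensor_lift B t = (\<Sum>i\<le>degree t. B (monom 1 i) (coeff t i))"

lemma coeff_tensor: "coeff (tensor f g) i = smult (coeff f i) g"
  by (simp add: tensor_def coeff_map_poly)

lemma vector_space_tensor: "vector_space tensor_scale"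
  unfolding tensor_scale_def
  by unfold_locales
    (simp_all add: smult_add_right smult_add_left[symmetric] mult.commute pCons_one)

lemma tensor_bilinear: "poly_bilinear tensor_scale tensor"
  unfolding poly_bilinear_def Vector_Spaces.linear_iff
  by (auto simp: vector_space_smult vector_space_tensor tensor_scale_def poly_eq_iff coeff_tensor
      algebra_simps)

lemma tensor_lift_extend:
  assumes B: "poly_bilinear s B" and n: "degree t \<le> n"
  shows "tensor_lift B t = (\<Sum>i\<le>n. B (monom 1 i) (coeff t i))"
proof -
  have "B (monom 1 i) 0 = 0" for i
  proof -
    have "Vector_Spaces.linear smult s (B (monom 1 i))"
      using B by (simp add: poly_bilinear_def)
    then interpret Vector_Spaces.linear smult s "B (monom 1 i)" .
    show ?thesis by (rule zero)
  qed
  then show ?thesis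
    unfolding tensor_lift_def
    using n by (intro sum.mono_neutral_left) (auto simp: coeff_eq_0)
qed

lemma tensor_lift_linear:
  assumes B: "poly_bilinear s B"
  shows "Vector_Spaces.linear tensor_scale s (tensor_lift B)"
proof -
  have lin: "poly_linear s (B p)" for p
    using B by (simp add: poly_bilinear_def)
  have vs: "vector_space s" and add: "B p (q + r) = B p q + B p r"
    and sc: "B p (smult c q) = s c (B p q)" for p q r c
    using lin[of p] by (auto simp: Vector_Spaces.linear_iff)
  interpret vector_space s by (rule vs)
  show ?thesis
    unfolding Vector_Spaces.linear_iff
  proof (intro conjI allI vs vector_space_tensor)
    fix t u :: poly_tensor
    let ?n = "max (degree t) (degree u)"
    have "degree (t + u) \<le> ?n" by (rule degree_add_le_max)
    then show "tensor_lift B (t + u) = tensor_lift B t + tensor_lift B u"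
      by (simp add: tensor_lift_extend[OF B, of _ ?n] add sum.distrib)
  next
    fix c and t :: poly_tensor
    have "degree (tensor_scale c t) \<le> degree t"
      by (simp add: tensor_scale_def)
    then show "tensor_lift B (tensor_scale c t) = s c (tensor_lift B t)"
      by (simp add: tensor_lift_extend[OF B, of _ "degree t"] tensor_scale_def sc scale_sum_right)
  qed
qed

lemma tensor_lift_tensor:
  assumes B: "poly_bilinear s B"
  shows "tensor_lift B (tensor f g) = B f g"
proof -
  have "poly_linear s (\<lambda>p. B p g)" and "poly_linear s (B p)" for p
    using B by (simp_all add: poly_bilinear_def)
  then interpret l: Vector_Spaces.linear smult s "\<lambda>p. B p g" by simp
  have sc: "B p (smult c q) = s c (B p q)" for p q c
    using \<open>\<And>p. poly_linear s (B p)\<close> by (auto simp: Vector_Spaces.linear_iff)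
  have "degree (tensor f g) \<le> degree f"
    by (rule degree_le) (simp add: coeff_tensor coeff_eq_0)
  then have "tensor_lift B (tensor f g) = (\<Sum>i\<le>degree f. B (smult (coeff f i) (monom 1 i)) g)"
    by (simp only: tensor_lift_extend[OF B] coeff_tensor sc l.scale)
  also have "\<dots> = B (\<Sum>i\<le>degree f. monom (coeff f i) i) g"
    by (simp add: l.sum smult_monom)
  finally show ?thesis
    by (simp add: poly_as_sum_of_monoms)
qed

lemma tensor_expand: "t = (\<Sum>i\<le>degree t. tensor (monom 1 i) (coeff t i))"
proof -
  have "tensor (monom 1 i) (coeff t i) = monom (coeff t i) i" for i
    by (auto simp: poly_eq_iff coeff_tensor)
  then show ?thesis
    by (simp add: poly_as_sum_of_monoms)
qed

lemma tensor_lift_unique: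
  assumes "Vector_Spaces.linear tensor_scale s L" and "\<And>f g. L (tensor f g) = B f g"
  shows "L = tensor_lift B"
proof
  fix t
  interpret Vector_Spaces.linear tensor_scale s L by fact
  show "L t = tensor_lift B t"
    by (subst tensor_expand) (simp add: sum assms(2) tensor_lift_def)
qed

definition fun_tensor_fun :: "(complex poly \<Rightarrow> complex) \<Rightarrow> poly_tensor \<Rightarrow> complex"
  where "fun_tensor_fun \<phi> = tensor_lift (\<lambda>f g. \<phi> f * \<phi> g)"

definition fun_tensor_id :: "(complex poly \<Rightarrow> complex) \<Rightarrow> poly_tensor \<Rightarrow> complex poly"
  where "fun_tensor_id \<phi> = tensor_lift (\<lambda>f g. smult (\<phi> f) g)"

definition id_tensor_fun :: "(complex poly \<Rightarrow> complex) \<Rightarrow> poly_tensor \<Rightarrow> complex poly"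
  where "id_tensor_fun \<phi> = tensor_lift (\<lambda>f g. smult (\<phi> g) f)"

lemma bilinear_functional_maps:
  assumes "poly_linear (*) \<phi>"
  shows "poly_bilinear (*) (\<lambda>f g. \<phi> f * \<phi> g)"
    and "poly_bilinear smult (\<lambda>f g. smult (\<phi> f) g)"
    and "poly_bilinear smult (\<lambda>f g. smult (\<phi> g) f)"
  using assms unfolding poly_bilinear_def Vector_Spaces.linear_iff
  by (auto simp: algebra_simps smult_add_left smult_add_right)

lemma functional_maps_tensor:
  assumes "poly_linear (*) \<phi>"
  shows "fun_tensor_fun \<phi> (tensor f g) = \<phi> f * \<phi> g"
    and "fun_tensor_id \<phi> (tensor f g) = smult (\<phi> f) g"
    and "id_tensor_fun \<phi> (tensor f g) = smult (\<phi> g) f"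
  unfolding fun_tensor_fun_def fun_tensor_id_def id_tensor_fun_def
  by (simp_all add: bilinear_functional_maps[OF assms, THEN tensor_lift_tensor])


section \<open>The non-commutative derivative\<close>

definition nc_deriv :: "complex poly \<Rightarrow> poly_tensor"
  where "nc_deriv p = (\<Sum>n\<le>degree p. tensor_scale (coeff p n)
    (\<Sum>k<n. tensor (monom 1 k) (monom 1 (n - k - 1))))"

lemma nc_deriv_extend:
  assumes "degree p \<le> m"
  shows "nc_deriv p = (\<Sum>n\<le>m. tensor_scale (coeff p n)
    (\<Sum>k<n. tensor (monom 1 k) (monom 1 (n - k - 1))))"
  unfolding nc_deriv_def
  using assms by (intro sum.mono_neutral_left) (auto simp: coeff_eq_0 tensor_scale_def)

lemma nc_deriv_linear: "poly_linear tensor_scale nc_deriv"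
proof -
  interpret vector_space tensor_scale by (rule vector_space_tensor)
  show ?thesis
    unfolding Vector_Spaces.linear_iff
  proof (intro conjI allI vector_space_smult vector_space_tensor)
    fix p q :: "complex poly"
    let ?m = "max (degree p) (degree q)"
    have "degree (p + q) \<le> ?m" by (rule degree_add_le_max)
    then show "nc_deriv (p + q) = nc_deriv p + nc_deriv q"
      by (simp add: nc_deriv_extend[of _ ?m] scale_left_distrib sum.distrib)
  next
    fix c and p :: "complex poly"
    show "nc_deriv (smult c p) = tensor_scale c (nc_deriv p)"
      by (simp add: nc_deriv_extend[of _ "degree p"] scale_sum_right)
  qed
qed

lemma nc_deriv_monom:
  "nc_deriv (monom 1 n) = (\<Sum>k<n. tensor (monom 1 k) (monom 1 (n - k - 1)))"
proof -
  have "nc_deriv (monom 1 n) = (\<Sum>j\<le>n. if j = n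
      then \<Sum>k<n. tensor (monom 1 k) (monom 1 (n - k - 1)) else 0)"
    unfolding nc_deriv_extend[of "monom 1 n" n, OF degree_monom_le]
    by (rule sum.cong) (auto simp: tensor_scale_def pCons_one)
  then show ?thesis by simp
qed


section \<open>Rescaled Chebyshev polynomials\<close>

fun chebC :: "nat \<Rightarrow> complex poly" where
  "chebC 0 = 2"
| "chebC (Suc 0) = [:0, 1:]"
| "chebC (Suc (Suc n)) = [:0, 1:] * chebC (Suc n) - chebC n"

fun chebS :: "nat \<Rightarrow> complex poly" where
  "chebS 0 = 1"
| "chebS (Suc 0) = [:0, 1:]"
| "chebS (Suc (Suc n)) = [:0, 1:] * chebS (Suc n) - chebS n"

text \<open>
  Both families are linear bases, so a linear functional may be prescribed on \<open>chebS\<close> and a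
  bilinear one on \<open>chebC\<close>, in exactly one way.
\<close>

lemma coeff_chebS: "coeff (chebS n) n = 1 \<and> (\<forall>m>n. coeff (chebS n) m = 0)"
proof (induction n rule: chebS.induct)
  case (3 n)
  then show ?case by (auto simp: coeff_pCons split: nat.split)
qed (auto simp: coeff_pCons split: nat.split)

lemma coeff_chebC: "coeff (chebC n) n \<noteq> 0 \<and> (\<forall>m>n. coeff (chebC n) m = 0)"
proof (induction n rule: chebC.induct)
  case 1
  have "coeff (2 :: complex poly) m = (if m = 0 then 2 else 0)" for m
    unfolding numeral_poly by (simp add: coeff_pCons split: nat.split)
  then show ?case by simp
next
  case (3 n)
  then show ?case by (auto simp: coeff_pCons split: nat.split)
qed (auto simp: coeff_pCons split: nat.split)

lemma triangular_prescription:
  fixes b :: "nat \<Rightarrow> complex poly" and s :: "complex \<Rightarrow> 'v::ab_group_add \<Rightarrow> 'v"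
  assumes b: "\<And>n. coeff (b n) n \<noteq> 0 \<and> (\<forall>m>n. coeff (b n) m = 0)" and s: "vector_space s"
  shows "\<exists>!\<phi>. poly_linear s \<phi> \<and> (\<forall>n. \<phi> (b n) = a n)"
proof -
  interpret vector_space_pair "smult :: complex \<Rightarrow> _" s
    by (intro vector_space_pair.intro vector_space_smult s)
  have inj: "inj b"
    by (rule injI) (metis b linorder_neqE_nat)
  have indep: "vs1.independent (range b)"
    unfolding vs1.independent_explicit_finite_subsets
  proof (intro allI impI ballI)
    fix A u v
    assume A: "A \<subseteq> range b" "finite A" and 0: "(\<Sum>w\<in>A. smult (u w) w) = 0" and v: "v \<in> A"
    obtain I where I: "A = b ` I" "finite I"
      using A by (metis finite_subset_image)
    have sumI: "(\<Sum>i\<in>I. smult (u (b i)) (b i)) = 0"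
      using 0 inj unfolding I(1) by (subst (asm) sum.reindex) (auto intro: inj_on_subset)
    have "\<forall>i\<in>I. u (b i) = 0"
    proof (rule ccontr)
      assume "\<not> ?thesis"
      define J where "J = {i \<in> I. u (b i) \<noteq> 0}"
      define m where "m = Max J"
      have J: "finite J" "J \<noteq> {}" using I \<open>\<not> (\<forall>i\<in>I. u (b i) = 0)\<close> by (auto simp: J_def)
      then have m: "m \<in> J" "\<And>i. i \<in> J \<Longrightarrow> i \<le> m" by (auto simp: m_def)
      have "0 = (\<Sum>i\<in>I. u (b i) * coeff (b i) m)"
        using arg_cong[OF sumI, of "\<lambda>p. coeff p m"] by (simp add: coeff_sum)
      also have "\<dots> = (\<Sum>i\<in>{m}. u (b i) * coeff (b i) m)"
      proof (rule sum.mono_neutral_right)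
        show "\<forall>i\<in>I - {m}. u (b i) * coeff (b i) m = 0"
        proof
          fix i assume i: "i \<in> I - {m}"
          show "u (b i) * coeff (b i) m = 0"
          proof (cases "i \<in> J")
            case True
            then have "i < m" using m(2)[of i] i by auto
            then show ?thesis using b by simp
          qed (use i in \<open>simp add: J_def\<close>)
        qed
      qed (use I m in \<open>auto simp: J_def\<close>)
      finally show False using m(1) b by (simp add: J_def)
    qed
    then show "u v = 0" using v I by auto
  qed
  have span: "p \<in> vs1.span (range b)" for p
  proof -
    have "\<forall>m\<ge>n. coeff p m = 0 \<Longrightarrow> p \<in> vs1.span (range b)" for n p
    proof (induction n arbitrary: p)
      case 0
      then have "p = 0" by (simp add: poly_eq_iff)
      then show ?case by (simp add: vs1.span_zero)
    next
      case (Suc n)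
      define c where "c = coeff p n / coeff (b n) n"
      have "p - smult c (b n) \<in> vs1.span (range b)"
      proof (rule Suc.IH, intro allI impI)
        fix m assume "n \<le> m"
        then show "coeff (p - smult c (b n)) m = 0"
          using Suc.prems b[of n] by (cases "m = n") (auto simp: c_def)
      qed
      moreover have "smult c (b n) \<in> vs1.span (range b)"
        by (intro vs1.span_scale vs1.span_base) simp
      ultimately have "(p - smult c (b n)) + smult c (b n) \<in> vs1.span (range b)"
        by (rule vs1.span_add)
      then show ?case by simp
    qed
    from this[of "Suc (degree p)" p] show ?thesis by (simp add: coeff_eq_0)
  qed
  obtain \<phi> where \<phi>: "poly_linear s \<phi>" "\<forall>x\<in>range b. \<phi> x = a (inv b x)"
    using linear_independent_extend[OF indep, of "\<lambda>x. a (inv b x)"] by blast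
  show ?thesis
  proof (rule ex1I[of _ \<phi>])
    show "poly_linear s \<phi> \<and> (\<forall>n. \<phi> (b n) = a n)"
      using \<phi> inj by simp
  next
    fix \<psi> assume \<psi>: "poly_linear s \<psi> \<and> (\<forall>n. \<psi> (b n) = a n)"
    show "\<psi> = \<phi>"
    proof
      fix p
      show "\<psi> p = \<phi> p"
        by (rule linear_eq_on[of \<psi> \<phi> p "range b"]) (use \<psi> \<phi> inj span in auto)
    qed
  qed
qed

lemma chebS_prescription: "\<exists>!\<phi>. poly_linear (*) \<phi> \<and> (\<forall>n. \<phi> (chebS n) = a n)"
  by (rule triangular_prescription) (use coeff_chebS vector_space_times in auto)

lemma chebC_prescription:
  "\<exists>!\<phi>. poly_bilinear (*) \<phi> \<and> (\<forall>n m. \<phi> (chebC n) (chebC m) = a n m)"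
proof -
  note uniq = triangular_prescription[OF coeff_chebC vector_space_times]
  define r where "r n = (THE f. poly_linear (*) f \<and> (\<forall>m. f (chebC m) = a n m))" for n
  have r: "poly_linear (*) (r n) \<and> (\<forall>m. r n (chebC m) = a n m)" for n
    unfolding r_def by (rule theI'[OF uniq])
  define \<phi> where
    "\<phi> p q = (THE f. poly_linear (*) f \<and> (\<forall>n. f (chebC n) = r n q)) p" for p q
  have \<phi>: "poly_linear (*) (\<lambda>p. \<phi> p q) \<and> (\<forall>n. \<phi> (chebC n) q = r n q)" for q
    unfolding \<phi>_def using theI'[OF uniq[of "\<lambda>n. r n q"]] by simp
  have eq: "f = g" if "poly_linear (*) f" "poly_linear (*) g"
    "\<And>n. f (chebC n) = (g (chebC n) :: complex)" for f g
    using uniq[of "\<lambda>n. g (chebC n)"] that by blast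
  have add: "\<phi> p (q + q') = \<phi> p q + \<phi> p q'" for p q q'
  proof -
    have "(\<lambda>p. \<phi> p (q + q')) = (\<lambda>p. \<phi> p q + \<phi> p q')"
    proof (rule eq)
      show "poly_linear (*) (\<lambda>p. \<phi> p q + \<phi> p q')"
        using \<phi>[of q] \<phi>[of q'] by (auto simp: Vector_Spaces.linear_iff algebra_simps)
      show "\<phi> (chebC n) (q + q') = \<phi> (chebC n) q + \<phi> (chebC n) q'" for n
        using \<phi> r[of n] by (auto simp: Vector_Spaces.linear_iff)
    qed (use \<phi> in blast)
    then show ?thesis by (rule fun_cong)
  qed
  have scale: "\<phi> p (smult c q) = c * \<phi> p q" for p q c
  proof -
    have "(\<lambda>p. \<phi> p (smult c q)) = (\<lambda>p. c * \<phi> p q)"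
    proof (rule eq)
      show "poly_linear (*) (\<lambda>p. c * \<phi> p q)"
        using \<phi>[of q] by (auto simp: Vector_Spaces.linear_iff algebra_simps)
      show "\<phi> (chebC n) (smult c q) = c * \<phi> (chebC n) q" for n
        using \<phi> r[of n] by (auto simp: Vector_Spaces.linear_iff)
    qed (use \<phi> in blast)
    then show ?thesis by (rule fun_cong)
  qed
  show ?thesis
  proof (rule ex1I[of _ \<phi>])
    show "poly_bilinear (*) \<phi> \<and> (\<forall>n m. \<phi> (chebC n) (chebC m) = a n m)"
      using \<phi> r add scale
      by (auto simp: poly_bilinear_def Vector_Spaces.linear_iff vector_space_smult vector_space_times)
  next
    fix \<psi> assume \<psi>: "poly_bilinear (*) \<psi> \<and> (\<forall>n m. \<psi> (chebC n) (chebC m) = a n m)"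
    have "\<psi> (chebC n) = r n" for n
      by (rule eq) (use \<psi> r in \<open>auto simp: poly_bilinear_def\<close>)
    then have "(\<lambda>p. \<psi> p q) = (\<lambda>p. \<phi> p q)" for q
      by (intro eq) (use \<psi> \<phi> in \<open>auto simp: poly_bilinear_def\<close>)
    then show "\<psi> = \<phi>" by (metis ext)
  qed
qed

end

theory Submission
  imports Defs
begin

text \<open>
  Continue the Chebyshev polynomials to all integer indices, \<open>C\<^sub>-\<^sub>n = C\<^sub>n\<close> and
  \<open>S\<^sub>-\<^sub>n = - S\<^sub>n\<^sub>-\<^sub>2\<close>, so that the product formulas hold without case distinctions. Continuing
  \<open>\<alpha>\<close> as an odd function keeps \<open>\<phi>1 (S\<^sub>n) = \<alpha>\<^sub>n\<^sub>+\<^sub>1\<close> valid for all integers, which is where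
  \<open>\<alpha>\<^sub>0 = 0\<close> enters. By linearity it suffices to take \<open>p = S\<^sub>n\<close> in the first equation and
  \<open>p = C\<^sub>n\<close>, \<open>q = C\<^sub>m\<close> in the second; both then become identities between finite sums, using
  \<open>\<partial> S\<^sub>n = (\<Sum>k<n. S\<^sub>k \<otimes> S\<^sub>n\<^sub>-\<^sub>1\<^sub>-\<^sub>k)\<close> and \<open>D C\<^sub>m = m S\<^sub>m\<^sub>-\<^sub>1\<close>.
\<close>

section \<open>Chebyshev polynomials with integer index: recursion, products, derivative\<close>

definition intC :: "int \<Rightarrow> complex poly"
  where "intC k = chebC (nat \<bar>k\<bar>)"

text \<open>The index is shifted by one against \<open>chebS\<close>, which makes \<open>intS\<close> an odd function.\<close>

definition intS :: "int \<Rightarrow> complex poly"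
  where "intS k = (if k > 0 then chebS (nat (k - 1)) else if k < 0 then - chebS (nat (- k - 1)) else 0)"

lemma intC_minus: "intC (- k) = intC k"
  by (simp add: intC_def)

lemma intS_minus: "intS (- k) = - intS k"
  by (simp add: intS_def)

lemma intC_of_nat [simp]: "intC (int n) = chebC n"
  by (simp add: intC_def)

lemma intS_Suc [simp]: "intS (1 + int n) = chebS n"
  by (simp add: intS_def)

text \<open>At index 0 this is x C_0 = 2x = C_1 + C_{-1}, which needs the normalization C_0 = 2.
  Negative indices follow from the reflection of k to -k, which swaps the two neighbours.\<close>

lemma intC_rec: "[:0, 1:] * intC k = intC (k + 1) + intC (k - 1)"
proof -
  have nat: "[:0, 1:] * intC (int n) = intC (int n + 1) + intC (int n - 1)" for n
  proof (cases n)
    case 0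
    then show ?thesis by (simp add: intC_def numeral_poly)
  next
    case (Suc m)
    have "nat \<bar>int (Suc m) + 1\<bar> = Suc (Suc m)" "nat \<bar>int (Suc m) - 1\<bar> = m"
      "nat \<bar>int (Suc m)\<bar> = Suc m" by auto
    then show ?thesis unfolding Suc intC_def by (simp only:) simp
  qed
  show ?thesis
  proof (cases "k \<ge> 0")
    case True
    then show ?thesis using nat[of "nat k"] by simp
  next
    case False
    then have "[:0, 1:] * intC (- k) = intC (- k + 1) + intC (- k - 1)"
      using nat[of "nat (- k)"] by simp
    moreover have "- k + 1 = - (k - 1)" "- k - 1 = - (k + 1)"
      by simp_all
    ultimately show ?thesis
      by (simp only: intC_minus add.commute)
  qed
qed

text \<open>Oddness makes both sides vanish at index 0, and \<open>intS 0 = 0\<close> turns index 1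
  into x S_0 = S_1.\<close>

lemma intS_rec: "[:0, 1:] * intS k = intS (k + 1) + intS (k - 1)"
proof -
  have nat: "[:0, 1:] * intS (int n) = intS (int n + 1) + intS (int n - 1)" for n
  proof (cases n rule: chebS.cases)
    case (3 m)
    have "nat (int (Suc (Suc m)) + 1 - 1) = Suc (Suc m)" "nat (int (Suc (Suc m)) - 1) = Suc m"
      "nat (int (Suc (Suc m)) - 1 - 1) = m" by auto
    then show ?thesis using 3 by (simp add: intS_def)
  qed (simp_all add: intS_def)
  show ?thesis
  proof (cases "k \<ge> 0")
    case True
    then show ?thesis using nat[of "nat k"] by simp
  next
    case False
    then have "[:0, 1:] * intS (- k) = intS (- k + 1) + intS (- k - 1)"
      using nat[of "nat (- k)"] by simp
    then have "[:0, 1:] * (- intS k) = - intS (k - 1) - intS (k + 1)"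
      using intS_minus[of k] intS_minus[of "k - 1"] intS_minus[of "k + 1"] by simp
    then show ?thesis by (metis (no_types, lifting) add.commute minus_add_distrib minus_equation_iff
        mult_minus_right uminus_add_conv_diff)
  qed
qed

text \<open>On a two-sided solution of the recursion, multiplication by x acts as T + T^{-1} with T
  the index shift, and the Chebyshev recursion then makes C_m act as T^m + T^{-m}. A general
  \<open>f\<close> covers \<open>intC\<close> and \<open>intS\<close> at once.\<close>

lemma chebC_times_rec:
  fixes f :: "int \<Rightarrow> complex poly"
  assumes f: "\<And>k. [:0, 1:] * f k = f (k + 1) + f (k - 1)"
  shows "chebC m * f k = f (k + int m) + f (k - int m)"
proof (induction m rule: chebC.induct)
  case 1
  show ?case by simp
next
  case 2
  show ?case by (simp only: chebC.simps f) simp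
next
  case (3 n)
  have "chebC (Suc (Suc n)) * f k = [:0, 1:] * (chebC (Suc n) * f k) - chebC n * f k"
    by (simp only: chebC.simps left_diff_distrib mult.assoc)
  also have "\<dots> = [:0, 1:] * f (k + int (Suc n)) + [:0, 1:] * f (k - int (Suc n))
      - (f (k + int n) + f (k - int n))"
    by (simp only: 3 distrib_left)
  also have "\<dots> = f (k + int (Suc (Suc n))) + f (k - int (Suc (Suc n)))"
    by (simp only: f) (simp add: algebra_simps)
  finally show ?case .
qed

lemmas chebC_times_intC = chebC_times_rec[of intC, OF intC_rec]
lemmas chebC_times_intS = chebC_times_rec[of intS, OF intS_rec]

text \<open>Both sides obey the same three-term recursion, so two initial cases decide.\<close>

lemma chebC_eq_chebS_diff: "chebC (Suc (Suc n)) = chebS (Suc (Suc n)) - chebS n"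
proof (induction n rule: chebS.induct)
  case (3 n)
  have "chebC (Suc (Suc (Suc (Suc n)))) =
      [:0, 1:] * (chebS (Suc (Suc (Suc n))) - chebS (Suc n)) - (chebS (Suc (Suc n)) - chebS n)"
    by (subst chebC.simps(3), subst 3(1), subst 3(2)) simp
  also have "\<dots> = chebS (Suc (Suc (Suc (Suc n)))) - chebS (Suc (Suc n))"
    by (simp add: algebra_simps)
  finally show ?case .
qed (simp_all add: numeral_poly one_pCons)

text \<open>Differentiating the recursion gives C_{n+2} + x D C_{n+2} - D C_{n+1}. After rewriting
  in the S basis, the coefficient of S_n is -1 + (n+2) - (n+1) = 0 and that of S_{n+2} is 1 +
  (n+2).\<close>

lemma pderiv_chebC: "pderiv (chebC (Suc n)) = smult (of_nat (Suc n)) (chebS n)"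
proof (induction n rule: chebS.induct)
  case 1
  show ?case by (simp add: pderiv_pCons one_pCons)
next
  case 2
  show ?case by (simp add: pderiv_pCons pderiv_diff numeral_poly)
next
  case (3 n)
  have X: "[:0, 1:] * chebS (Suc n) = chebS (Suc (Suc n)) + chebS n" by simp
  have "pderiv (chebC (Suc (Suc (Suc n)))) = chebC (Suc (Suc n))
      + [:0, 1:] * pderiv (chebC (Suc (Suc n))) - pderiv (chebC (Suc n))"
    by (subst chebC.simps(3)) (simp add: pderiv_diff pderiv_mult pderiv_pCons del: chebC.simps)
  also have "\<dots> = smult (of_nat (Suc (Suc (Suc n)))) (chebS (Suc (Suc n)))"
    unfolding 3 mult_smult_right X
    by (simp only: chebC_eq_chebS_diff of_nat_Suc smult_add_left smult_add_right smult_1_left) simp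
  finally show ?case .
qed

section \<open>The non-commutative derivative in the Chebyshev bases\<close>

lemma tensor_add: "tensor (f + g) h = tensor f h + tensor g h"
    "tensor f (g + h) = tensor f g + tensor f h"
  by (simp_all add: poly_eq_iff coeff_tensor algebra_simps)

lemma tensor_diff: "tensor f (g - h) = tensor f g - tensor f h"
  by (simp add: poly_eq_iff coeff_tensor algebra_simps)

lemma tensor_2: "tensor p 2 = tensor p 1 + tensor p 1"
  by (simp only: tensor_add flip: one_add_one)

text \<open>With \<open>tensor_pCons\<close> this decodes the representation: \<open>pCons 0\<close>
  multiplies by x \<otimes> 1, so \<open>pCons q t\<close> stands for 1 \<otimes> q + (x \<otimes>
  1) t.\<close>

lemma tensor_1: "tensor 1 q = [:q:]"
  by (rule poly_eqI) (simp add: coeff_tensor coeff_pCons split: nat.split)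

lemma tensor_pCons: "tensor (pCons 0 f) g = pCons 0 (tensor f g)"
  by (rule poly_eqI) (simp add: coeff_tensor coeff_pCons split: nat.split)

lemma pCons_0_sum: "pCons 0 (sum f A) = (\<Sum>n\<in>A. pCons 0 (f n))"
  by (simp add: poly_eq_iff coeff_sum coeff_pCons split: nat.split)

lemma nc_deriv_diff: "nc_deriv (p - q) = nc_deriv p - nc_deriv q"
proof -
  interpret Vector_Spaces.linear smult tensor_scale nc_deriv by (rule nc_deriv_linear)
  show ?thesis by (rule diff)
qed

lemma nc_deriv_const [simp]: "nc_deriv [:c:] = 0"
  by (simp add: nc_deriv_def tensor_scale_def)

text \<open>The Leibniz rule \<open>\<partial> (x p) = 1 \<otimes> p + (x \<otimes> 1) \<partial> p\<close>.\<close>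

lemma nc_deriv_pCons: "nc_deriv (pCons 0 p) = pCons p (nc_deriv p)"
proof -
  define t where "t n = (\<Sum>k<n. tensor (monom 1 k) (monom 1 (n - k - 1) :: complex poly))" for n
  \<comment> \<open>The summand k = 0 splits off; all others share a factor x on the left.\<close>
  have t_Suc: "t (Suc n) = [:monom 1 n:] + pCons 0 (t n)" for n
    unfolding t_def sum.lessThan_Suc_shift
    by (simp add: monom_Suc tensor_pCons tensor_1 pCons_0_sum)
  have "nc_deriv (pCons 0 p) =
      (\<Sum>n\<le>Suc (degree p). tensor_scale (coeff (pCons 0 p) n) (t n))"
    unfolding t_def by (rule nc_deriv_extend) (rule degree_pCons_le)
  also have "\<dots> = (\<Sum>n\<le>degree p. tensor_scale (coeff p n) (t (Suc n)))"
    by (subst sum.atMost_Suc_shift) (simp add: tensor_scale_def)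
  also have "\<dots> = (\<Sum>n\<le>degree p. [:monom (coeff p n) n:] + pCons 0 (tensor_scale (coeff p n) (t n)))"
    by (simp add: t_Suc tensor_scale_def smult_monom smult_add_right)
  also have "\<dots> = [:\<Sum>n\<le>degree p. monom (coeff p n) n:] + pCons 0 (nc_deriv p)"
    unfolding sum.distrib pCons_0_sum[symmetric] nc_deriv_def t_def
    by (simp add: sum_to_poly)
  finally show ?thesis
    by (simp add: poly_as_sum_of_monoms)
qed

lemma nc_deriv_X: "nc_deriv [:0, 1:] = tensor 1 1"
  using nc_deriv_pCons[of 1] nc_deriv_const[of 1] by (simp add: tensor_1 flip: one_pCons)

text \<open>The Leibniz rule is applied to the recursion and x S_k is expanded in the left factor;
  the lower neighbours add up to \<partial> S_n, which the recursion subtracts again.\<close>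

lemma nc_deriv_chebS: "nc_deriv (chebS n) = (\<Sum>k<n. tensor (chebS k) (chebS (n - Suc k)))"
proof (induction n rule: chebS.induct)
  case 1
  show ?case using nc_deriv_const[of 1] by (simp add: one_pCons)
next
  case 2
  show ?case by (simp add: nc_deriv_X)
next
  case (3 n)
  let ?T = "\<lambda>i j. tensor (chebS i) (chebS j)"
  have X: "pCons 0 (chebS (Suc k)) = chebS (Suc (Suc k)) + chebS k" for k
    by simp
  have "nc_deriv (chebS (Suc (Suc n))) =
      pCons (chebS (Suc n)) (nc_deriv (chebS (Suc n))) - nc_deriv (chebS n)"
    by (simp add: nc_deriv_diff nc_deriv_pCons)
  also have "pCons (chebS (Suc n)) (nc_deriv (chebS (Suc n))) =
      ?T 0 (Suc n) + (\<Sum>k<Suc n. tensor (pCons 0 (chebS k)) (chebS (n - k)))"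
  proof -
    have "pCons g (sum f A) = tensor 1 g + (\<Sum>k\<in>A. pCons 0 (f k))" for g f and A :: "nat set"
      by (simp add: tensor_1 flip: pCons_0_sum)
    then show ?thesis
      unfolding 3 tensor_pCons chebS.simps(1) diff_Suc_Suc .
  qed
  \<comment> \<open>The term k = 0 stays apart because x S_0 = S_1 has no lower neighbour.\<close>
  also have "(\<Sum>k<Suc n. tensor (pCons 0 (chebS k)) (chebS (n - k))) =
      ?T 1 n + (\<Sum>k<n. ?T (Suc (Suc k)) (n - Suc k)) + (\<Sum>k<n. ?T k (n - Suc k))"
    unfolding sum.lessThan_Suc_shift X tensor_add sum.distrib by (simp add: one_pCons)
  also have "?T 0 (Suc n) + \<dots> - nc_deriv (chebS n) =
      (\<Sum>k<Suc (Suc n). ?T k (Suc (Suc n) - Suc k))"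
    unfolding 3 sum.lessThan_Suc_shift by (simp del: chebS.simps)
  finally show ?case .
qed

text \<open>The mixed form suits \<open>\<phi>1\<close>, known on the S basis, and
  \<open>\<phi>2\<close>, known on the C basis. It comes from C_{n+1} = S_{n+1} - S_{n-1} by pairing
  the right factors into S_j - S_{j-2} = C_j; the final term corrects k = n, where S_0 = 1 but C_0 =
  2.\<close>

lemma nc_deriv_chebC:
  "nc_deriv (chebC (Suc n)) = (\<Sum>k\<le>n. tensor (chebS k) (chebC (n - k))) - tensor (chebS n) 1"
proof (cases n)
  case 0
  then show ?thesis by (simp add: nc_deriv_X tensor_2)
next
  case (Suc m)
  let ?T = "\<lambda>i j. tensor (chebS i) (chebS j)"
  have "(\<Sum>k\<le>n. tensor (chebS k) (chebC (n - k))) = (\<Sum>k<m. tensor (chebS k) (chebC (Suc m - k)))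
      + tensor (chebS m) (chebC 1) + tensor (chebS (Suc m)) 2"
    by (simp add: Suc lessThan_Suc_atMost[symmetric] Suc_diff_le del: chebC.simps(3) chebS.simps(3))
  also have "(\<Sum>k<m. tensor (chebS k) (chebC (Suc m - k))) =
      (\<Sum>k<m. ?T k (Suc m - k)) - (\<Sum>k<m. ?T k (m - Suc k))"
    unfolding sum_subtractf[symmetric]
  proof (rule sum.cong)
    fix k assume "k \<in> {..<m}"
    then have "Suc m - k = Suc (Suc (m - Suc k))" by auto
    then show "tensor (chebS k) (chebC (Suc m - k)) = ?T k (Suc m - k) - ?T k (m - Suc k)"
      by (simp only: chebC_eq_chebS_diff tensor_diff)
  qed simp
  finally show ?thesis
    by (simp add: Suc chebC_eq_chebS_diff nc_deriv_diff nc_deriv_chebS tensor_2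
        del: chebC.simps(3) chebS.simps(3))
qed

text \<open>Each \<partial> x^n is invariant under swapping the tensor factors, as reversing the
  summation shows.\<close>

lemma id_tensor_fun_nc_deriv:
  assumes \<phi>: "poly_linear (*) \<phi>"
  shows "id_tensor_fun \<phi> (nc_deriv p) = fun_tensor_id \<phi> (nc_deriv p)"
proof -
  let ?t = "\<lambda>n. \<Sum>k<n. tensor (monom 1 k) (monom 1 (n - k - 1) :: complex poly)"
  interpret l: Vector_Spaces.linear tensor_scale smult "id_tensor_fun \<phi>"
    unfolding id_tensor_fun_def by (intro tensor_lift_linear bilinear_functional_maps \<phi>)
  interpret r: Vector_Spaces.linear tensor_scale smult "fun_tensor_id \<phi>"
    unfolding fun_tensor_id_def by (intro tensor_lift_linear bilinear_functional_maps \<phi>)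
  have "id_tensor_fun \<phi> (?t n) = fun_tensor_id \<phi> (?t n)" for n
  proof -
    have "fun_tensor_id \<phi> (?t n) = (\<Sum>k<n. smult (\<phi> (monom 1 k)) (monom 1 (n - Suc k)))"
      by (simp add: r.sum functional_maps_tensor[OF \<phi>])
    also have "\<dots> = (\<Sum>k<n. smult (\<phi> (monom 1 (n - Suc k))) (monom 1 k))"
      by (subst sum.nat_diff_reindex[symmetric]) (auto intro!: sum.cong)
    finally show ?thesis
      by (simp add: l.sum functional_maps_tensor[OF \<phi>])
  qed
  then show ?thesis
    unfolding nc_deriv_def by (simp only: l.sum r.sum l.scale r.scale)
qed

section \<open>Linear extension from a basis and the convolution sum\<close>

lemma poly_linear_iff:
  fixes f :: "complex poly \<Rightarrow> complex"
  shows "poly_linear (*) f \<longleftrightarrow> (\<forall>p q. f (p + q) = f p + f q) \<and> (\<forall>c p. f (smult c p) = c * f p)"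
  by (auto simp: Vector_Spaces.linear_iff vector_space_smult vector_space_times)

lemma poly_linear_eqI:
  fixes f g :: "complex poly \<Rightarrow> complex"
  assumes b: "\<And>n. coeff (b n) n \<noteq> 0 \<and> (\<forall>m>n. coeff (b n) m = 0)"
    and "poly_linear (*) f" "poly_linear (*) g" and "\<And>n. f (b n) = g (b n)"
  shows "f = g"
  using triangular_prescription[OF b vector_space_times, of "\<lambda>n. g (b n)"] assms(2-4) by blast

text \<open>For m > n oddness gives a (1 + n - m) = -\<alpha> (m - n - 1), and shifting m by n + 1
  cancels these terms against the first summands. The convolution over m \<le> n remains, and its
  term m = 0 vanishes.\<close>

lemma sum_odd_extension:
  fixes \<alpha> :: "nat \<Rightarrow> complex" and a :: "int \<Rightarrow> complex"
  assumes a: "\<And>n. a (int n) = \<alpha> n" "\<And>n. a (- int n) = - \<alpha> n" and 0: "\<alpha> 0 = 0"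
    and fin: "finite {n. \<alpha> n \<noteq> 0}"
  shows "(\<Sum>m | \<alpha> m \<noteq> 0. \<alpha> m * (a (1 + int n + int m) + a (1 + int n - int m))) =
    (\<Sum>k<n. \<alpha> (Suc k) * \<alpha> (n - k))"
proof -
  obtain N where N: "{n. \<alpha> n \<noteq> 0} \<subseteq> {..N}"
    using fin by (metis finite_nat_set_iff_bounded_le atMost_iff subsetI)
  \<comment> \<open>Chosen so that {n + 1..?M} is exactly {0..N} shifted by n + 1.\<close>
  let ?M = "n + Suc N"
  have "(\<Sum>m | \<alpha> m \<noteq> 0. \<alpha> m * (a (1 + int n + int m) + a (1 + int n - int m))) =
      (\<Sum>m\<in>{0..?M}. \<alpha> m * (a (1 + int n + int m) + a (1 + int n - int m)))"
    using N by (intro sum.mono_neutral_left) auto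
  also have "\<dots> = (\<Sum>m\<in>{0..?M}. \<alpha> m * a (1 + int n + int m))
      + (\<Sum>m\<in>{0..?M}. \<alpha> m * a (1 + int n - int m))"
    by (simp only: distrib_left sum.distrib)
  also have "(\<Sum>m\<in>{0..?M}. \<alpha> m * a (1 + int n + int m)) = (\<Sum>m\<in>{0..N}. \<alpha> m * \<alpha> (m + (n + 1)))"
  proof (rule sum.mono_neutral_cong_right)
    show "\<forall>m\<in>{0..?M} - {0..N}. \<alpha> m * a (1 + int n + int m) = 0" using N by auto
    show "\<alpha> m * a (1 + int n + int m) = \<alpha> m * \<alpha> (m + (n + 1))" for m
      using a(1)[of "m + (n + 1)"] by (simp add: algebra_simps)
  qed auto
  also have "(\<Sum>m\<in>{0..?M}. \<alpha> m * a (1 + int n - int m)) =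
      (\<Sum>m\<in>{0..n}. \<alpha> m * a (1 + int n - int m)) + (\<Sum>m\<in>{n + 1..?M}. \<alpha> m * a (1 + int n - int m))"
    by (rule sum.ub_add_nat) simp
  also have "(\<Sum>m\<in>{n + 1..?M}. \<alpha> m * a (1 + int n - int m)) = - (\<Sum>m\<in>{0..N}. \<alpha> m * \<alpha> (m + (n + 1)))"
  proof -
    have "{n + 1..?M} = {0 + (n + 1)..N + (n + 1)}" by simp
    then have "(\<Sum>m\<in>{n + 1..?M}. \<alpha> m * a (1 + int n - int m)) =
        (\<Sum>m\<in>{0..N}. \<alpha> (m + (n + 1)) * a (1 + int n - int (m + (n + 1))))"
      by (simp only: sum.shift_bounds_cl_nat_ivl)
    also have "\<dots> = (\<Sum>m\<in>{0..N}. - (\<alpha> m * \<alpha> (m + (n + 1))))"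
    proof (rule sum.cong)
      fix m
      have "1 + int n - int (m + (n + 1)) = - int m" by simp
      then show "\<alpha> (m + (n + 1)) * a (1 + int n - int (m + (n + 1))) = - (\<alpha> m * \<alpha> (m + (n + 1)))"
        by (simp only: a) simp
    qed simp
    finally show ?thesis by (simp only: sum_negf)
  qed
  also have "(\<Sum>m\<in>{0..n}. \<alpha> m * a (1 + int n - int m)) = (\<Sum>m\<le>n. \<alpha> m * \<alpha> (Suc n - m))"
  proof (rule sum.cong)
    fix m assume "m \<in> {..n}"
    then have "1 + int n - int m = int (Suc n - m)" by auto
    then show "\<alpha> m * a (1 + int n - int m) = \<alpha> m * \<alpha> (Suc n - m)"
      by (simp only: a)
  qed auto
  also have "\<dots> = (\<Sum>k<n. \<alpha> (Suc k) * \<alpha> (n - k))"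
    by (subst sum.atMost_shift) (simp add: 0)
  finally show ?thesis by simp
qed

section \<open>The two Schwinger-Dyson equations\<close>

theorem mainTheorem1:
  fixes V \<xi> :: "complex poly" and \<alpha> :: "nat \<Rightarrow> complex"
    and \<phi>1 :: "complex poly \<Rightarrow> complex"
    and \<phi>2 :: "complex poly \<Rightarrow> complex poly \<Rightarrow> complex"
  assumes "\<xi> = pderiv V"
    and "finite {n. \<alpha> n \<noteq> 0}"
    and "\<xi> = (\<Sum>n | \<alpha> n \<noteq> 0. smult (\<alpha> n) (chebC n))"
    and "\<alpha> 0 = 0" and "\<alpha> 1 = 1"
    and "poly_linear (*) \<phi>1"
    and "\<And>n. \<phi>1 (chebS n) = \<alpha> (n + 1)"
    and "poly_bilinear (*) \<phi>2"
    and "\<And>n m. \<phi>2 (chebC n) (chebC m) = (if n = m then of_nat n else 0)"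
  shows "(\<forall>p. \<phi>1 (\<xi> * p) = fun_tensor_fun \<phi>1 (nc_deriv p)) \<and>
    (\<forall>p q. \<phi>2 (\<xi> * p) q =
      \<phi>2 (fun_tensor_id \<phi>1 (nc_deriv p) + id_tensor_fun \<phi>1 (nc_deriv p)) q
      + \<phi>1 (p * pderiv q))"
proof -
  let ?A = "{n. \<alpha> n \<noteq> 0}"
  note fin = assms(2) and \<xi> = assms(3) and \<alpha>0 = assms(4) and lin1 = assms(6) and \<phi>1 = assms(7)
    and bil2 = assms(8) and \<phi>2 = assms(9)
  interpret l1: Vector_Spaces.linear smult "(*)" \<phi>1 by (rule lin1)
  have lin2: "poly_linear (*) (\<lambda>p. \<phi>2 p q)" "poly_linear (*) (\<phi>2 p)" for p q
    using bil2 by (auto simp: poly_bilinear_def)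
  interpret l2: Vector_Spaces.linear smult "(*)" "\<lambda>p. \<phi>2 p q" for q by (rule lin2)
  interpret r2: Vector_Spaces.linear smult "(*)" "\<phi>2 p" for p by (rule lin2)
  interpret ff: Vector_Spaces.linear tensor_scale "(*)" "fun_tensor_fun \<phi>1"
    unfolding fun_tensor_fun_def by (intro tensor_lift_linear bilinear_functional_maps lin1)
  interpret fi: Vector_Spaces.linear tensor_scale smult "fun_tensor_id \<phi>1"
    unfolding fun_tensor_id_def by (intro tensor_lift_linear bilinear_functional_maps lin1)
  interpret nc: Vector_Spaces.linear smult tensor_scale nc_deriv by (rule nc_deriv_linear)
  note tens = functional_maps_tensor[OF lin1]

  define a where "a k = (if k \<ge> 0 then \<alpha> (nat k) else - \<alpha> (nat (- k)))" for k
  have a_nat: "a (int n) = \<alpha> n" "a (- int n) = - \<alpha> n" for n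
    using \<alpha>0 by (auto simp: a_def)
  have \<phi>1_intS: "\<phi>1 (intS k) = a k" for k
  proof -
    have "Suc (nat (k - 1)) = nat k" if "k > 0" using that by auto
    moreover have "Suc (nat (- k - 1)) = nat (- k)" if "k < 0" using that by auto
    ultimately show ?thesis
      using \<alpha>0 by (simp add: intS_def a_def \<phi>1 l1.neg l1.zero)
  qed
  have \<phi>2_intC: "\<phi>2 (intC k) (chebC m) = (if \<bar>k\<bar> = int m then of_nat m else 0)" for k m
    by (auto simp: intC_def \<phi>2)

  have first: "(\<lambda>p. \<phi>1 (\<xi> * p)) = (\<lambda>p. fun_tensor_fun \<phi>1 (nc_deriv p))"
  proof (rule poly_linear_eqI[of chebS])
    show "poly_linear (*) (\<lambda>p. \<phi>1 (\<xi> * p))"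
      by (simp add: poly_linear_iff distrib_left l1.add l1.scale)
    show "poly_linear (*) (\<lambda>p. fun_tensor_fun \<phi>1 (nc_deriv p))"
      by (simp add: poly_linear_iff nc.add nc.scale ff.add ff.scale)
    fix n
    have "\<xi> * intS (1 + int n) =
        (\<Sum>m\<in>?A. smult (\<alpha> m) (intS (1 + int n + int m) + intS (1 + int n - int m)))"
      unfolding \<xi> sum_distrib_right mult_smult_left chebC_times_intS ..
    then have "\<phi>1 (\<xi> * chebS n) = (\<Sum>m\<in>?A. \<alpha> m * (a (1 + int n + int m) + a (1 + int n - int m)))"
      by (simp only: intS_Suc l1.sum l1.scale l1.add \<phi>1_intS)
    also have "\<dots> = (\<Sum>k<n. \<alpha> (Suc k) * \<alpha> (n - k))"
      by (rule sum_odd_extension) (use a_nat \<alpha>0 fin in auto)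
    also have "\<dots> = fun_tensor_fun \<phi>1 (nc_deriv (chebS n))"
      unfolding nc_deriv_chebS ff.sum tens \<phi>1 by (rule sum.cong) (auto simp: Suc_diff_Suc)
    finally show "\<phi>1 (\<xi> * chebS n) = fun_tensor_fun \<phi>1 (nc_deriv (chebS n))" .
  qed (simp add: coeff_chebS)

  \<comment> \<open>Unlike the odd \<open>a\<close>, this extends \<alpha> by zero:
    \<open>b k\<close> is what a sum over j weighted by \<alpha> collects from the condition j =
    k.\<close>
  define b where "b k = (if k \<ge> 0 then \<alpha> (nat k) else 0)" for k
  have a_b: "a k = b k - b (- k)" for k
    using \<alpha>0 by (auto simp: a_def b_def)
  have sum_b: "(\<Sum>j\<in>?A. \<alpha> j * (if int j = k then 1 else 0)) = b k" for k
  proof -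
    have "(\<Sum>j\<in>?A. \<alpha> j * (if int j = k then 1 else 0)) =
        (\<Sum>j\<in>?A. if nat k = j then if k \<ge> 0 then \<alpha> j else 0 else 0)"
      by (rule sum.cong) auto
    then show ?thesis using fin by (simp add: b_def)
  qed
  have half: "\<phi>2 (fun_tensor_id \<phi>1 (nc_deriv (chebC n))) (chebC m) = of_nat m * b (int n - int m)"
    for n m
  proof (cases n)
    case 0
    then show ?thesis
      using \<alpha>0 nc_deriv_const[of 2] by (simp add: numeral_poly fi.zero l2.zero b_def)
  next
    case (Suc l)
    \<comment> \<open>Constants are multiples of C_0, which has weight 0 under
      \<open>\<phi>2\<close>; hence the correction term of \<open>nc_deriv_chebC\<close> drops
      out.\<close>
    have "\<phi>2 [:c:] (chebC m) = 0" for c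
      using \<phi>2[of 0 m] l2.scale[of "c / 2" 2 "chebC m"] by (cases "m = 0") (simp_all add: numeral_poly)
    then have "\<phi>2 (fun_tensor_id \<phi>1 (nc_deriv (chebC n))) (chebC m) =
        (\<Sum>k\<le>l. \<alpha> (Suc k) * (if l - k = m then of_nat m else 0))"
      unfolding Suc nc_deriv_chebC
      by (simp add: fi.diff fi.sum tens l2.diff l2.sum l2.scale \<phi>1 \<phi>2) (auto intro!: sum.cong)
    also have "\<dots> = (\<Sum>k\<le>l. if k = l - m then if m \<le> l then \<alpha> (Suc k) * of_nat m else 0 else 0)"
      by (rule sum.cong) auto
    also have "\<dots> = of_nat m * b (int n - int m)"
    proof -
      \<comment> \<open>If m > l, then n - m is at most 0, where \<open>b\<close> vanishes: by
        definition below 0, and by \<alpha> 0 = 0 at 0.\<close>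
      have "nat (int n - int m) = Suc (l - m)" if "m \<le> l" using that Suc by auto
      then show ?thesis using Suc \<alpha>0 by (auto simp: b_def not_le le_Suc_eq)
    qed
    finally show ?thesis .
  qed

  \<comment> \<open>The factor 2 merges the two one-sided terms, equal by
    \<open>id_tensor_fun_nc_deriv\<close>.\<close>
  have "(\<lambda>p. \<phi>2 (\<xi> * p) q) = (\<lambda>p. 2 * \<phi>2 (fun_tensor_id \<phi>1 (nc_deriv p)) q + \<phi>1 (p * pderiv q))"
    for q
  proof (rule poly_linear_eqI[of chebC])
    show "poly_linear (*) (\<lambda>p. \<phi>2 (\<xi> * p) q)"
      by (simp add: poly_linear_iff distrib_left l2.add l2.scale)
    show "poly_linear (*) (\<lambda>p. 2 * \<phi>2 (fun_tensor_id \<phi>1 (nc_deriv p)) q + \<phi>1 (p * pderiv q))"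
      by (simp add: poly_linear_iff nc.add nc.scale fi.add fi.scale l2.add l2.scale l1.add l1.scale
          distrib_left distrib_right mult.left_commute)
    fix n
    have "(\<lambda>q. \<phi>2 (\<xi> * chebC n) q) =
        (\<lambda>q. 2 * \<phi>2 (fun_tensor_id \<phi>1 (nc_deriv (chebC n))) q + \<phi>1 (chebC n * pderiv q))"
    proof (rule poly_linear_eqI[of chebC])
      show "poly_linear (*) (\<lambda>q. \<phi>2 (\<xi> * chebC n) q)"
        by (rule lin2)
      show "poly_linear (*) (\<lambda>q. 2 * \<phi>2 (fun_tensor_id \<phi>1 (nc_deriv (chebC n))) q
          + \<phi>1 (chebC n * pderiv q))"
        by (simp add: poly_linear_iff r2.add r2.scale pderiv_add pderiv_smult l1.add l1.scale
            distrib_left mult.left_commute)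
      fix m
      have "\<xi> * intC (int n) =
          (\<Sum>j\<in>?A. smult (\<alpha> j) (intC (int n + int j) + intC (int n - int j)))"
        unfolding \<xi> sum_distrib_right mult_smult_left chebC_times_intC ..
      then have L: "\<phi>2 (\<xi> * chebC n) (chebC m) = (\<Sum>j\<in>?A. \<alpha> j *
          ((if \<bar>int n + int j\<bar> = int m then of_nat m else 0)
            + (if \<bar>int n - int j\<bar> = int m then of_nat m else 0)))"
        by (simp only: intC_of_nat l2.sum l2.scale l2.add \<phi>2_intC)
      show "\<phi>2 (\<xi> * chebC n) (chebC m) = 2 * \<phi>2 (fun_tensor_id \<phi>1 (nc_deriv (chebC n))) (chebC m)
          + \<phi>1 (chebC n * pderiv (chebC m))"
      proof (cases m)
        case 0
        then show ?thesis
          unfolding L half by (simp add: numeral_poly l1.zero pderiv_pCons cong: if_cong)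
      next
        case (Suc l)
        have "chebC n * pderiv (chebC m) = smult (of_nat m) (chebC n * intS (int m))"
          using intS_Suc[of l] by (simp add: Suc pderiv_chebC del: intS_Suc)
        also have "\<dots> = smult (of_nat m) (intS (int m + int n) + intS (int m - int n))"
          by (simp only: chebC_times_intS)
        finally have R: "\<phi>1 (chebC n * pderiv (chebC m)) =
            of_nat m * (a (int m + int n) + a (int m - int n))"
          by (simp only: l1.scale l1.add \<phi>1_intS)
        \<comment> \<open>The condition |n + j| = m means j = m - n, while |n - j| = m means j = n +
          m or j = n - m, distinct because m > 0.\<close>
        have "\<phi>2 (\<xi> * chebC n) (chebC m) = (\<Sum>j\<in>?A. of_nat m *
            (\<alpha> j * (if int j = int m - int n then 1 else 0)
             + \<alpha> j * (if int j = int m + int n then 1 else 0)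
             + \<alpha> j * (if int j = int n - int m then 1 else 0)))"
          unfolding L using Suc by (intro sum.cong) auto
        also have "\<dots> = of_nat m * (b (int m - int n) + b (int m + int n) + b (int n - int m))"
          by (simp only: sum_distrib_left[symmetric] sum.distrib sum_b)
        \<comment> \<open>Replacing b (m - n) by a (m - n) + b (n - m) supplies the second copy of b
          (n - m).\<close>
        also have "\<dots> = 2 * (of_nat m * b (int n - int m))
            + of_nat m * (a (int m + int n) + a (int m - int n))"
        proof -
          have "a (int m + int n) = b (int m + int n)"
            by (simp add: a_def b_def)
          moreover have "a (int m - int n) = b (int m - int n) - b (int n - int m)"
            using a_b[of "int m - int n"] by simp
          ultimately show ?thesis
            by (simp only:) (simp add: distrib_left right_diff_distrib)
        qed
        finally show ?thesis
          by (simp only: half R)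
      qed
    qed (rule coeff_chebC)
    then show "\<phi>2 (\<xi> * chebC n) q =
        2 * \<phi>2 (fun_tensor_id \<phi>1 (nc_deriv (chebC n))) q + \<phi>1 (chebC n * pderiv q)"
      by (rule fun_cong)
  qed (rule coeff_chebC)
  then have "\<phi>2 (\<xi> * p) q = 2 * \<phi>2 (fun_tensor_id \<phi>1 (nc_deriv p)) q + \<phi>1 (p * pderiv q)" for p q
    by (rule fun_cong)
  then show ?thesis
    using fun_cong[OF first] unfolding id_tensor_fun_nc_deriv[OF lin1] l2.add by simp
qed

end
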